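(* Let $p>1$, $\frac1p+\frac1q=1$, $\alpha>0$, $\beta\in(0,1]$, $x>1$, and let $f,g$ be two positive functions on $[1,\infty)$ such that $\mathcal{H}^{\alpha,\beta}_{1,x}[f^{p}(x)]<\infty$ and $\mathcal{H}^{\alpha,\beta}_{1,x}[g^{q}(x)]<\infty$. If $m,M$ are real constants such that $0<m\le\frac{f(\tau)^{p}}{g(\tau)^{q}}\le M<\infty$ for all $\tau\in[1,x]$, then $$\left[\mathcal{H}^{\alpha,\beta}_{1,x}[f^{p}(x)]\right]^{\frac1p}\left[\mathcal{H}^{\alpha,\beta}_{1,x}[g^{q}(x)]\right]^{\frac1q}\le\left(\frac{M}{m}\right)^{\frac{1}{pq}}\mathcal{H}^{\alpha,\beta}_{1,x}[f(x)g(x)].$$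
   Context: For $\alpha>0$, $\beta\in(0,1]$ and $x>1$, the one-sided generalized proportional Hadamard fractional integral of a (measurable) function $z$ on $[1,\infty)$ is $$\mathcal{H}^{\alpha,\beta}_{1,x}[z(x)]=(\mathcal{H}^{\alpha,\beta}_{1,x}z)(x)=\frac{1}{\beta^{\alpha}\Gamma(\alpha)}\int_{1}^{x}e^{\frac{\beta-1}{\beta}(\ln x-\ln t)}(\ln x-\ln t)^{\alpha-1}\frac{z(t)}{t}\,dt,$$ where $\Gamma$ is the gamma function. Functions are real-valued and measurable; $f^p(x)$ means $(f(x))^p$ and $g^q(x)$ means $(g(x))^q$. *)

theory Defs
  imports "HOL-Analysis.Analysis"
begin

definition gph_integrand :: "real \<Rightarrow> real \<Rightarrow> real \<Rightarrow> (real \<Rightarrow> real) \<Rightarrow> real \<Rightarrow> real" where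
  "gph_integrand \<alpha> \<beta> x z t =
     exp ((\<beta> - 1) / \<beta> * (ln x - ln t)) * (ln x - ln t) powr (\<alpha> - 1) * (z t / t)"

(* Lebesgue integral over [1, x]; the value of the integrand at the endpoint t = x, where
   0 powr (\<alpha> - 1) = 0 by convention, is irrelevant. As usual for the Bochner integral, the value
   is 0 when the integrand is not integrable, so finiteness is expressed separately below. *)
definition gph_integral :: "real \<Rightarrow> real \<Rightarrow> (real \<Rightarrow> real) \<Rightarrow> real \<Rightarrow> real" where
  "gph_integral \<alpha> \<beta> z x =
     1 / (\<beta> powr \<alpha> * Gamma \<alpha>) * (LINT t|lebesgue_on {1..x}. gph_integrand \<alpha> \<beta> x z t)"

(* Lebesgue integrability of the integrand. For measurable z \<ge> 0 this says exactly that the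
   fractional integral of z at x, as an element of [0, \<infinity>], is < \<infinity>. *)
definition gph_finite :: "real \<Rightarrow> real \<Rightarrow> (real \<Rightarrow> real) \<Rightarrow> real \<Rightarrow> bool" where
  "gph_finite \<alpha> \<beta> z x \<longleftrightarrow> integrable (lebesgue_on {1..x}) (gph_integrand \<alpha> \<beta> x z)"

end

theory Submission imports Defs begin

text \<open>
  This is a reverse Hoelder inequality, and it rests on the linearity and monotonicity of the
  fractional integral, whose kernel is nonnegative. Since \<open>1/p + 1/q = 1\<close>, any two of
  \<open>f\<^sup>p\<close>, \<open>g\<^sup>q\<close> and \<open>f g\<close> are comparable once the ratio \<open>f\<^sup>p / g\<^sup>q\<close> is pinched between \<open>m\<close> and \<open>M\<close>:
  writing \<open>f\<^sup>p = (f\<^sup>p)\<^bsup>1/p\<^esup> (f\<^sup>p)\<^bsup>1/q\<^esup>\<close> and bounding the second factor gives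
  \<open>f\<^sup>p \<le> M\<^bsup>1/q\<^esup> f g\<close>, and exchanging the roles of \<open>f\<close> and \<open>g\<close> gives
  \<open>g\<^sup>q \<le> (1/m)\<^bsup>1/p\<^esup> f g\<close> (lemma \<open>powr_le_mult_of_powr_ratio_le\<close>). Integrating both, raising them to
  the powers \<open>1/p\<close> and \<open>1/q\<close>, and multiplying produces \<open>(M/m)\<^bsup>1/(pq)\<^esup>\<close> times the integral of \<open>f g\<close>.

  Monotonicity of the integral is only meaningful for integrable functions, because the Bochner
  integral of a non-integrable function is 0. Hence \<open>f g\<close> has to be shown integrable first; this is
  Young's inequality \<open>f g \<le> f\<^sup>p / p + g\<^sup>q / q\<close> (lemma \<open>gph_finite_mult\<close>).
\<close>

text \<open>
  Both pointwise estimates come from this one lemma: \<open>C = M\<close> bounds \<open>f\<^sup>p\<close>, and after exchanging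
  \<open>(a, p)\<close> with \<open>(b, q)\<close>, under which the conjugacy condition is symmetric, \<open>C = 1/m\<close> bounds \<open>g\<^sup>q\<close>.
\<close>
lemma powr_le_mult_of_powr_ratio_le:
  fixes a b p q C :: real
  assumes "a > 0" "b > 0" "q > 1" and conj: "1 / p + 1 / q = 1"
    and ratio: "a powr p / b powr q \<le> C"
  shows "a powr p \<le> C powr (1 / q) * (a * b)"
proof -
  have "p \<noteq> 0" using assms(3) conj by auto
  have "0 < a powr p / b powr q" using assms by simp
  hence C: "C > 0" using ratio by linarith
  have "a powr p \<le> C * b powr q"
    using ratio assms(2) by (simp add: divide_simps)
  hence "(a powr p) powr (1 / q) \<le> (C * b powr q) powr (1 / q)"
    using assms(3) by (intro powr_mono2) auto
  also have "\<dots> = C powr (1 / q) * b"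
    using C assms(2,3) by (simp add: powr_mult powr_powr)
  finally have *: "(a powr p) powr (1 / q) \<le> C powr (1 / q) * b" .
  have "a powr p = (a powr p) powr (1 / p + 1 / q)"
    using conj by simp
  also have "\<dots> = a * (a powr p) powr (1 / q)"
    unfolding powr_add using \<open>p \<noteq> 0\<close> assms(1) by (simp add: powr_powr)
  also have "\<dots> \<le> a * (C powr (1 / q) * b)"
    using * assms(1) by (intro mult_left_mono) auto
  finally show ?thesis by (simp add: mult_ac)
qed

lemma gph_integrand_mono:
  assumes "t > 0" "z t \<le> w t"
  shows "gph_integrand \<alpha> \<beta> x z t \<le> gph_integrand \<alpha> \<beta> x w t"
  unfolding gph_integrand_def
  using assms by (intro mult_left_mono divide_right_mono) auto

lemma gph_finite_add:
  assumes "gph_finite \<alpha> \<beta> z x" "gph_finite \<alpha> \<beta> w x"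
  shows "gph_finite \<alpha> \<beta> (\<lambda>t. z t + w t) x"
proof -
  have "gph_integrand \<alpha> \<beta> x (\<lambda>t. z t + w t) =
        (\<lambda>t. gph_integrand \<alpha> \<beta> x z t + gph_integrand \<alpha> \<beta> x w t)"
    by (simp add: gph_integrand_def fun_eq_iff add_divide_distrib distrib_left)
  thus ?thesis using assms by (simp add: gph_finite_def)
qed

lemma gph_integrand_cmult:
  "gph_integrand \<alpha> \<beta> x (\<lambda>t. c * z t) = (\<lambda>t. c * gph_integrand \<alpha> \<beta> x z t)"
  by (simp add: gph_integrand_def fun_eq_iff)

lemma gph_finite_cmult:
  "gph_finite \<alpha> \<beta> z x \<Longrightarrow> gph_finite \<alpha> \<beta> (\<lambda>t. c * z t) x"
  by (simp add: gph_finite_def gph_integrand_cmult)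

lemma gph_finite_bound:
  assumes meas: "z \<in> borel_measurable (lebesgue_on {1..})"
    and fin: "gph_finite \<alpha> \<beta> w x"
    and bound: "\<And>t. t \<in> {1..x} \<Longrightarrow> 0 \<le> z t \<and> z t \<le> w t"
  shows "gph_finite \<alpha> \<beta> z x"
proof -
  have [measurable]: "z \<in> borel_measurable (lebesgue_on {1..x})"
    using meas by (rule measurable_restrict_mono) auto
  have [measurable]: "(\<lambda>t. t) \<in> borel_measurable (lebesgue_on {1..x})"
    by (intro measurable_restrict_space1 measurable_completion) simp
  have "gph_integrand \<alpha> \<beta> x z \<in> borel_measurable (lebesgue_on {1..x})"
    unfolding gph_integrand_def by measurable
  moreover have "AE t in lebesgue_on {1..x}.
      norm (gph_integrand \<alpha> \<beta> x z t) \<le> norm (gph_integrand \<alpha> \<beta> x w t)"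
  proof (rule AE_I2)
    fix t assume "t \<in> space (lebesgue_on {1..x})"
    hence t: "t \<in> {1..x}" by simp
    have "0 \<le> gph_integrand \<alpha> \<beta> x z t"
      using bound[OF t] t by (simp add: gph_integrand_def)
    moreover have "gph_integrand \<alpha> \<beta> x z t \<le> gph_integrand \<alpha> \<beta> x w t"
      using bound[OF t] t by (intro gph_integrand_mono) auto
    ultimately show "norm (gph_integrand \<alpha> \<beta> x z t) \<le> norm (gph_integrand \<alpha> \<beta> x w t)"
      by simp
  qed
  ultimately show ?thesis
    using fin unfolding gph_finite_def by (blast intro: Bochner_Integration.integrable_bound)
qed

lemma gph_finite_mult:
  assumes "p > 1" "q > 1" "1 / p + 1 / q = 1"
    and "f \<in> borel_measurable (lebesgue_on {1..})" "g \<in> borel_measurable (lebesgue_on {1..})"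
    and nonneg: "\<And>t. t \<in> {1..x} \<Longrightarrow> 0 \<le> f t \<and> 0 \<le> g t"
    and "gph_finite \<alpha> \<beta> (\<lambda>t. f t powr p) x" "gph_finite \<alpha> \<beta> (\<lambda>t. g t powr q) x"
  shows "gph_finite \<alpha> \<beta> (\<lambda>t. f t * g t) x"
proof (rule gph_finite_bound)
  show "(\<lambda>t. f t * g t) \<in> borel_measurable (lebesgue_on {1..})"
    using assms by measurable
  show "gph_finite \<alpha> \<beta> (\<lambda>t. 1 / p * f t powr p + 1 / q * g t powr q) x"
    using assms by (intro gph_finite_add gph_finite_cmult)
  show "0 \<le> f t * g t \<and> f t * g t \<le> 1 / p * f t powr p + 1 / q * g t powr q"
    if "t \<in> {1..x}" for t
    using Youngs_inequality[OF assms(1-3), of "f t" "g t"] nonneg[OF that] by simp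
qed

lemma gph_integral_nonneg:
  assumes "\<alpha> > 0" "\<And>t. t \<in> {1..x} \<Longrightarrow> 0 \<le> z t"
  shows "0 \<le> gph_integral \<alpha> \<beta> z x"
  unfolding gph_integral_def
  using assms
  by (intro mult_nonneg_nonneg integral_nonneg_AE AE_I2)
     (auto simp: gph_integrand_def Gamma_real_nonneg)

lemma gph_integral_le_cmult:
  assumes "\<alpha> > 0" and fin: "gph_finite \<alpha> \<beta> z x" "gph_finite \<alpha> \<beta> w x"
    and le: "\<And>t. t \<in> {1..x} \<Longrightarrow> z t \<le> c * w t"
  shows "gph_integral \<alpha> \<beta> z x \<le> c * gph_integral \<alpha> \<beta> w x"
proof -
  have "(LINT t|lebesgue_on {1..x}. gph_integrand \<alpha> \<beta> x z t)
      \<le> (LINT t|lebesgue_on {1..x}. gph_integrand \<alpha> \<beta> x (\<lambda>t. c * w t) t)"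
    using fin gph_finite_cmult[OF fin(2), of c] le unfolding gph_finite_def
    by (intro integral_mono gph_integrand_mono) auto
  hence "(LINT t|lebesgue_on {1..x}. gph_integrand \<alpha> \<beta> x z t)
      \<le> c * (LINT t|lebesgue_on {1..x}. gph_integrand \<alpha> \<beta> x w t)"
    by (simp add: gph_integrand_cmult)
  hence "1 / (\<beta> powr \<alpha> * Gamma \<alpha>) * (LINT t|lebesgue_on {1..x}. gph_integrand \<alpha> \<beta> x z t)
      \<le> 1 / (\<beta> powr \<alpha> * Gamma \<alpha>) * (c * (LINT t|lebesgue_on {1..x}. gph_integrand \<alpha> \<beta> x w t))"
    using assms(1) by (intro mult_left_mono) (auto simp: Gamma_real_nonneg)
  thus ?thesis by (simp add: gph_integral_def mult_ac)
qed

theorem theorem4p2: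
  fixes p q \<alpha> \<beta> x m M :: real and f g :: "real \<Rightarrow> real"
  assumes "p > 1" and "1 / p + 1 / q = 1"
    and "\<alpha> > 0" and "0 < \<beta>" and "\<beta> \<le> 1" and "x > 1"
    and "f \<in> borel_measurable (lebesgue_on {1..})"
    and "g \<in> borel_measurable (lebesgue_on {1..})"
    and "\<And>t. t \<ge> 1 \<Longrightarrow> f t > 0"
    and "\<And>t. t \<ge> 1 \<Longrightarrow> g t > 0"
    and "gph_finite \<alpha> \<beta> (\<lambda>t. f t powr p) x"
    and "gph_finite \<alpha> \<beta> (\<lambda>t. g t powr q) x"
    and "0 < m"
    and "\<And>\<tau>. \<tau> \<in> {1..x} \<Longrightarrow> m \<le> f \<tau> powr p / g \<tau> powr q \<and> f \<tau> powr p / g \<tau> powr q \<le> M"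
  shows "gph_integral \<alpha> \<beta> (\<lambda>t. f t powr p) x powr (1 / p)
           * gph_integral \<alpha> \<beta> (\<lambda>t. g t powr q) x powr (1 / q)
         \<le> (M / m) powr (1 / (p * q)) * gph_integral \<alpha> \<beta> (\<lambda>t. f t * g t) x"
proof -
  have q: "q > 1"
  proof -
    have "1 / q = 1 - 1 / p" using assms(2) by linarith
    hence "0 < 1 / q" "1 / q < 1" using assms(1) by auto
    thus ?thesis by (simp add: divide_simps split: if_splits)
  qed
  have M: "M > 0"
    using assms(6) assms(13) assms(14)[of 1] by auto
  define I where "I = gph_integral \<alpha> \<beta> (\<lambda>t. f t * g t) x"
  define F where "F = gph_integral \<alpha> \<beta> (\<lambda>t. f t powr p) x"
  define G where "G = gph_integral \<alpha> \<beta> (\<lambda>t. g t powr q) x"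
  have pos: "f t > 0" "g t > 0" if "t \<in> {1..x}" for t
    using that assms(9,10) by auto
  have fin: "gph_finite \<alpha> \<beta> (\<lambda>t. f t * g t) x"
    using assms(1) q assms(2,7,8) _ assms(11,12)
    by (rule gph_finite_mult) (use pos in \<open>auto intro: less_imp_le\<close>)
  have nonneg: "0 \<le> I" "0 \<le> F" "0 \<le> G"
    unfolding I_def F_def G_def using assms(3) pos
    by (auto intro!: gph_integral_nonneg intro: less_imp_le)
  have "F \<le> M powr (1 / q) * I"
    unfolding F_def I_def using assms(3,11) fin
  proof (rule gph_integral_le_cmult)
    fix t assume t: "t \<in> {1..x}"
    show "f t powr p \<le> M powr (1 / q) * (f t * g t)"
      using pos[OF t] q assms(2) assms(14)[OF t] by (intro powr_le_mult_of_powr_ratio_le) auto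
  qed
  hence "F powr (1 / p) \<le> (M powr (1 / q) * I) powr (1 / p)"
    using nonneg assms(1) by (intro powr_mono2) auto
  also have "\<dots> = M powr (1 / (p * q)) * I powr (1 / p)"
    using nonneg M by (simp add: powr_mult powr_powr mult.commute)
  finally have F: "F powr (1 / p) \<le> M powr (1 / (p * q)) * I powr (1 / p)" .
  have "G \<le> (1 / m) powr (1 / p) * I"
    unfolding G_def I_def using assms(3,12) fin
  proof (rule gph_integral_le_cmult)
    fix t assume t: "t \<in> {1..x}"
    have "g t powr q / f t powr p \<le> 1 / m"
      using assms(13) assms(14)[OF t] pos[OF t] by (simp add: field_simps)
    hence "g t powr q \<le> (1 / m) powr (1 / p) * (g t * f t)"
      using pos[OF t] assms(1,2) by (intro powr_le_mult_of_powr_ratio_le) auto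
    thus "g t powr q \<le> (1 / m) powr (1 / p) * (f t * g t)"
      by (simp add: mult.commute)
  qed
  hence "G powr (1 / q) \<le> ((1 / m) powr (1 / p) * I) powr (1 / q)"
    using nonneg q by (intro powr_mono2) auto
  also have "\<dots> = (1 / m) powr (1 / (p * q)) * I powr (1 / q)"
    using nonneg assms(13) by (simp add: powr_mult powr_powr)
  finally have G: "G powr (1 / q) \<le> (1 / m) powr (1 / (p * q)) * I powr (1 / q)" .
  have "F powr (1 / p) * G powr (1 / q)
      \<le> (M powr (1 / (p * q)) * I powr (1 / p)) * ((1 / m) powr (1 / (p * q)) * I powr (1 / q))"
    using F G by (intro mult_mono) auto
  also have "\<dots> = (M powr (1 / (p * q)) * (1 / m) powr (1 / (p * q))) * I powr (1 / p + 1 / q)"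
    by (simp add: powr_add mult_ac)
  also have "\<dots> = (M / m) powr (1 / (p * q)) * I"
    using nonneg M assms(2,13) by (simp flip: powr_mult)
  finally show ?thesis
    by (simp add: F_def G_def I_def)
qed

end
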